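(* Let $G=(V,E)$ be a finite simple undirected graph and $\lambda\in(1/2,1)$. Consider the following algorithm. Compute an optimal solution $x=(x_{ij})$ of the LP $$\min\sum_{(i,j)\in E}(1-\lambda)x_{ij}+\sum_{(i,j)\notin E}\lambda(1-x_{ij})\quad\text{s.t. } x_{ij}\le x_{ik}+x_{jk}\ \forall\text{ distinct }i,j,k,\quad 0\le x_{ij}\le1.$$ Set $W\leftarrow V$, $\mathcal{C}\leftarrow\emptyset$. While $W\neq\emptyset$: choose any $u\in W$; let $T=\{i\in W\setminus\{u\}:x_{ui}\le 2/5\}$; if $T\neq\emptyset$ and $\frac1{|T|}\sum_{i\in T}x_{ui}<1/5$, let $S=\{u\}\cup T$, otherwise let $S=\{u\}$; add $S$ to $\mathcal{C}$ and set $W\leftarrow W\setminus S$. Then, regardless of the choices of $u$, the output partition $\mathcal{C}$ has standard LambdaCC objective at most $5$ times the minimum standard LambdaCC objective over all partitions of $V$.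
   Context: Variables $x_{ij}=x_{ji}$ are indexed by unordered pairs of distinct nodes. The standard LambdaCC objective of a partition of $V$ is $(1-\lambda)$ times the number of edges of $G$ between different clusters plus $\lambda$ times the number of non-adjacent pairs of distinct nodes in a common cluster; the LP is its relaxation (with $x_{ij}$ the relaxed indicator that $i,j$ are separated). *)

theory Defs
  imports Complex_Main "HOL-Library.Ramsey" "HOL-Library.Disjoint_Sets"
begin

text \<open>
  A finite simple undirected graph is a finite vertex set \<open>V\<close> with an edge set
  \<open>E \<subseteq> [V]\<^bsup>2\<^esup>\<close>; its non-adjacent pairs of distinct nodes are \<open>[V]\<^bsup>2\<^esup> - E\<close>.
  The variables \<open>x\<^sub>i\<^sub>j = x\<^sub>j\<^sub>i\<close> are the values \<open>x {i, j}\<close> of a function on sets; values of \<open>x\<close>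
  outside \<open>[V]\<^bsup>2\<^esup>\<close> are irrelevant.
\<close>

definition lcc_objective :: "'a set \<Rightarrow> 'a set set \<Rightarrow> real \<Rightarrow> 'a set set \<Rightarrow> real" where
  "lcc_objective V E l C =
     (1 - l) * real (card {{i, j} | i j. {i, j} \<in> E \<and> (\<exists>S\<in>C. \<exists>T\<in>C. S \<noteq> T \<and> i \<in> S \<and> j \<in> T)})
     + l * real (card {{i, j} | i j. {i, j} \<in> [V]\<^bsup>2\<^esup> - E \<and> (\<exists>S\<in>C. i \<in> S \<and> j \<in> S)})"

definition lcc_lp_feasible :: "'a set \<Rightarrow> ('a set \<Rightarrow> real) \<Rightarrow> bool" where
  "lcc_lp_feasible V x \<longleftrightarrow>
     (\<forall>i\<in>V. \<forall>j\<in>V. \<forall>k\<in>V. i \<noteq> j \<and> i \<noteq> k \<and> j \<noteq> k \<longrightarrow> x {i, j} \<le> x {i, k} + x {j, k}) \<and>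
     (\<forall>i\<in>V. \<forall>j\<in>V. i \<noteq> j \<longrightarrow> 0 \<le> x {i, j} \<and> x {i, j} \<le> 1)"

definition lcc_lp_objective ::
    "'a set \<Rightarrow> 'a set set \<Rightarrow> real \<Rightarrow> ('a set \<Rightarrow> real) \<Rightarrow> real" where
  "lcc_lp_objective V E l x = (\<Sum>e\<in>E. (1 - l) * x e) + (\<Sum>e\<in>[V]\<^bsup>2\<^esup> - E. l * (1 - x e))"

definition lcc_lp_optimal :: "'a set \<Rightarrow> 'a set set \<Rightarrow> real \<Rightarrow> ('a set \<Rightarrow> real) \<Rightarrow> bool" where
  "lcc_lp_optimal V E l x \<longleftrightarrow> is_arg_min (lcc_lp_objective V E l) (lcc_lp_feasible V) x"

definition pivot_cluster :: "('a set \<Rightarrow> real) \<Rightarrow> 'a set \<Rightarrow> 'a \<Rightarrow> 'a set" where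
  "pivot_cluster x W u =
     (let T = {i \<in> W - {u}. x {u, i} \<le> 2 / 5}
      in if T \<noteq> {} \<and> (1 / real (card T)) * (\<Sum>i\<in>T. x {u, i}) < 1 / 5 then {u} \<union> T else {u})"

text \<open>
  \<open>lcc_round x W C D\<close>: the while loop, started with unclustered nodes \<open>W\<close> and clusters
  \<open>C\<close>, can terminate with output \<open>D\<close> for some choice of pivots.
\<close>

inductive lcc_round :: "('a set \<Rightarrow> real) \<Rightarrow> 'a set \<Rightarrow> 'a set set \<Rightarrow> 'a set set \<Rightarrow> bool"
  for x where
  finished: "lcc_round x {} C C"
| pivot: "u \<in> W \<Longrightarrow> lcc_round x (W - pivot_cluster x W u) (C \<union> {pivot_cluster x W u}) D
    \<Longrightarrow> lcc_round x W C D"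

text \<open>
  Every choice of pivots leads to an output: each iteration shrinks \<open>W\<close>, and from
  every state with finite \<open>W\<close> the loop can be completed.
\<close>

lemma pivot_cluster_decreases:
  assumes "u \<in> W"
  shows "W - pivot_cluster x W u \<subset> W"
  using assms by (auto simp: pivot_cluster_def Let_def)

lemma lcc_round_exists:
  assumes "finite W"
  shows "\<exists>D. lcc_round x W C D"
  using assms
proof (induction W arbitrary: C rule: finite_psubset_induct)
  case (psubset W)
  show ?case
  proof (cases "W = {}")
    case True
    then show ?thesis by (auto intro: lcc_round.finished)
  next
    case False
    then obtain u where "u \<in> W" by blast
    then show ?thesis
      using psubset.IH[OF pivot_cluster_decreases] lcc_round.pivot by metis
  qed
qed

end

theory Submission
  imports Defs
begin

text \<open>
  The objective of a partition is the LP objective of its separation indicator, so the optimal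
  LP value is a lower bound for every partition. It remains to charge each iteration, with
  cluster \<open>S\<close> and remaining nodes \<open>W - S\<close>, to five times the LP cost of the pairs it removes.
  Non-edges inside \<open>S\<close> have \<open>x \<le> 4/5\<close> by the triangle inequality through the pivot \<open>u\<close>.
  If \<open>S = {u}\<close>, then, as \<open>l \<ge> 1 - l\<close> and \<open>x \<le> 1/2\<close> on \<open>T\<close>, all pairs between \<open>u\<close> and \<open>T\<close>
  together cost at least \<open>(1 - l) * (\<Sum>i\<in>T. x {u, i}) \<ge> (1 - l) * |T| / 5\<close>.
  If \<open>S = {u} \<union> T\<close> and \<open>j\<close> lies outside \<open>S\<close>, then either \<open>x {u, j} \<ge> 3/5\<close>, and every pair
  \<open>{i, j}\<close> with \<open>i \<in> S\<close> has \<open>x {i, j} \<ge> 1/5\<close>, or \<open>2/5 < x {u, j} < 3/5\<close>, and the triangle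
  inequalities give LP cost at least \<open>(1 - l) * (2/5 - x {u, i})\<close> for the pair \<open>{i, j}\<close>,
  which is at least \<open>(1 - l) / 5\<close> on average over \<open>i \<in> S\<close>.
\<close>

section \<open>Pair costs and partitions as LP points\<close>

definition pair_cost :: "'a set set \<Rightarrow> real \<Rightarrow> ('a set \<Rightarrow> real) \<Rightarrow> 'a set \<Rightarrow> real" where
  "pair_cost E l y e = (if e \<in> E then (1 - l) * y e else l * (1 - y e))"

definition separation :: "'a set set \<Rightarrow> 'a set \<Rightarrow> real" where
  "separation P e = (if \<exists>S\<in>P. e \<subseteq> S then 0 else 1)"

lemma nsets_2_cases:
  assumes "e \<in> [V]\<^bsup>2\<^esup>"
  obtains i j where "e = {i, j}" "i \<in> V" "j \<in> V" "i \<noteq> j"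
  using assms by (auto simp: nsets_def card_2_iff)

lemma doubleton_in_nsets_2: "{i, j} \<in> [V]\<^bsup>2\<^esup> \<longleftrightarrow> i \<in> V \<and> j \<in> V \<and> i \<noteq> j"
  by (auto simp: nsets_def card_2_iff doubleton_eq_iff)

text \<open>Merging the edge and non-edge sums gives one sum over all pairs, which can then be split
  by position relative to a cluster instead of by adjacency.\<close>

lemma lcc_lp_objective_eq_sum_pair_cost:
  assumes "finite V" and "E \<subseteq> [V]\<^bsup>2\<^esup>"
  shows "lcc_lp_objective V E l y = sum (pair_cost E l y) ([V]\<^bsup>2\<^esup>)"
proof -
  have "sum (pair_cost E l y) ([V]\<^bsup>2\<^esup>)
      = sum (pair_cost E l y) ([V]\<^bsup>2\<^esup> - E) + sum (pair_cost E l y) E"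
    by (rule sum.subset_diff[OF assms(2) finite_imp_finite_nsets[OF assms(1)]])
  then show ?thesis
    by (simp add: lcc_lp_objective_def pair_cost_def)
qed

text \<open>Every node lies in exactly one cluster, so a pair meets two different clusters exactly
  when no single cluster contains it.\<close>

lemma lcc_objective_eq_lp_objective:
  assumes "finite V" and E: "E \<subseteq> [V]\<^bsup>2\<^esup>" and P: "partition_on V P"
  shows "lcc_objective V E l P = lcc_lp_objective V E l (separation P)"
proof -
  have fin: "finite E" "finite ([V]\<^bsup>2\<^esup> - E)"
    using finite_imp_finite_nsets[OF assms(1)] E finite_subset by auto
  have covered: "\<exists>S\<in>P. i \<in> S" if "i \<in> V" for i
    using P that by (auto simp: partition_on_def)
  have unique: "S = T" if "S \<in> P" "T \<in> P" "i \<in> S" "i \<in> T" for S T i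
    using P that by (auto simp: partition_on_def disjoint_def)
  have cut: "{{i, j} | i j. {i, j} \<in> E \<and> (\<exists>S\<in>P. \<exists>T\<in>P. S \<noteq> T \<and> i \<in> S \<and> j \<in> T)}
      = {e \<in> E. \<not> (\<exists>S\<in>P. e \<subseteq> S)}" (is "?L = ?R")
  proof
    show "?L \<subseteq> ?R"
    proof
      fix e assume "e \<in> ?L"
      then obtain i j S T where e: "e = {i, j}" "e \<in> E"
        and ST: "S \<in> P" "T \<in> P" "S \<noteq> T" "i \<in> S" "j \<in> T"
        by auto
      have False if "A \<in> P" "e \<subseteq> A" for A
        using unique[of A S i] unique[of A T j] e ST that by auto
      then show "e \<in> ?R"
        using e by auto
    qed
    show "?R \<subseteq> ?L"
    proof
      fix e assume e: "e \<in> ?R"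
      then have "e \<in> [V]\<^bsup>2\<^esup>"
        using E by auto
      then obtain i j where ij: "e = {i, j}" "i \<in> V" "j \<in> V"
        by (rule nsets_2_cases)
      obtain S T where ST: "S \<in> P" "i \<in> S" "T \<in> P" "j \<in> T"
        using covered ij by meson
      then have "S \<noteq> T"
        using e ij by auto
      then have "\<exists>S\<in>P. \<exists>T\<in>P. S \<noteq> T \<and> i \<in> S \<and> j \<in> T"
        using ST by metis
      moreover have "{i, j} \<in> E"
        using e ij by simp
      ultimately show "e \<in> ?L"
        unfolding ij(1) by (intro CollectI exI[of _ i] exI[of _ j]) simp
    qed
  qed
  have joined: "{{i, j} | i j. {i, j} \<in> [V]\<^bsup>2\<^esup> - E \<and> (\<exists>S\<in>P. i \<in> S \<and> j \<in> S)}
      = {e \<in> [V]\<^bsup>2\<^esup> - E. \<exists>S\<in>P. e \<subseteq> S}" (is "?L = ?R")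
  proof
    show "?L \<subseteq> ?R"
      by (intro subsetI, elim CollectE exE) simp
    show "?R \<subseteq> ?L"
    proof
      fix e assume e: "e \<in> ?R"
      then have "e \<in> [V]\<^bsup>2\<^esup>"
        by simp
      then obtain i j where ij: "e = {i, j}"
        by (rule nsets_2_cases)
      have "{i, j} \<in> [V]\<^bsup>2\<^esup> - E" "\<exists>S\<in>P. i \<in> S \<and> j \<in> S"
        using e ij by simp_all
      then show "e \<in> ?L"
        unfolding ij by (intro CollectI exI[of _ i] exI[of _ j]) simp
    qed
  qed
  have "(\<Sum>e\<in>E. separation P e) = real (card {e \<in> E. \<not> (\<exists>S\<in>P. e \<subseteq> S)})"
    using fin(1) by (simp add: separation_def sum.If_cases Int_def)
  moreover have "(\<Sum>e\<in>[V]\<^bsup>2\<^esup> - E. 1 - separation P e)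
      = (\<Sum>e\<in>[V]\<^bsup>2\<^esup> - E. if \<exists>S\<in>P. e \<subseteq> S then 1 else 0)"
    by (intro sum.cong) (auto simp: separation_def)
  moreover have "\<dots> = real (card {e \<in> [V]\<^bsup>2\<^esup> - E. \<exists>S\<in>P. e \<subseteq> S})"
    using fin(2) by (subst sum.If_cases) (auto simp: Int_def)
  ultimately show ?thesis
    unfolding lcc_objective_def lcc_lp_objective_def cut joined
    by (simp flip: sum_distrib_left)
qed

text \<open>For 0-1 values the triangle inequality fails only if both terms on the right vanish;
  then the two clusters share \<open>k\<close>, hence coincide and contain \<open>i\<close> and
  \<open>j\<close>.\<close>

lemma separation_feasible:
  assumes "partition_on V P"
  shows "lcc_lp_feasible V (separation P)"
proof -
  have range: "0 \<le> separation P e" "separation P e \<le> 1" for e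
    by (simp_all add: separation_def)
  have "separation P {i, j} \<le> separation P {i, k} + separation P {j, k}" for i j k
  proof (cases "(\<exists>S\<in>P. {i, k} \<subseteq> S) \<and> (\<exists>T\<in>P. {j, k} \<subseteq> T)")
    case True
    then obtain S T where ST: "S \<in> P" "T \<in> P" "{i, k} \<subseteq> S" "{j, k} \<subseteq> T"
      by meson
    then have "S = T"
      using assms by (auto simp: partition_on_def disjoint_def)
    then have "\<exists>S\<in>P. {i, j} \<subseteq> S"
      using ST by (intro bexI[of _ S]) simp_all
    then have "separation P {i, j} = 0"
      unfolding separation_def by (rule if_P)
    then show ?thesis
      using range by simp
  next
    case False
    then have "separation P {i, k} = 1 \<or> separation P {j, k} = 1"
      unfolding separation_def by argo
    then show ?thesis
      using range[of "{i, j}"] range(1)[of "{i, k}"] range(1)[of "{j, k}"] by linarith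
  qed
  then show ?thesis
    using range by (simp add: lcc_lp_feasible_def)
qed

text \<open>A pair has zero, two or one endpoint in \<open>S\<close>. The last kind corresponds
  bijectively to \<open>(W - S) \<times> S\<close>, since the factors are disjoint.\<close>

lemma sum_nsets_2_split:
  fixes f :: "'a set \<Rightarrow> real"
  assumes "finite W" and "S \<subseteq> W"
  shows "sum f ([W]\<^bsup>2\<^esup>)
    = sum f ([W - S]\<^bsup>2\<^esup>) + sum f ([S]\<^bsup>2\<^esup>) + (\<Sum>j\<in>W - S. \<Sum>i\<in>S. f {i, j})"
proof -
  let ?pair = "\<lambda>(j, i). {i, j}"
  let ?X = "?pair ` ((W - S) \<times> S)"
  have fin: "finite S" "finite (W - S)"
    using assms finite_subset by auto
  have split: "[W]\<^bsup>2\<^esup> = [W - S]\<^bsup>2\<^esup> \<union> [S]\<^bsup>2\<^esup> \<union> ?X"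
  proof
    show "[W]\<^bsup>2\<^esup> \<subseteq> [W - S]\<^bsup>2\<^esup> \<union> [S]\<^bsup>2\<^esup> \<union> ?X"
    proof
      fix e assume "e \<in> [W]\<^bsup>2\<^esup>"
      then obtain i j where "e = {i, j}" "i \<in> W" "j \<in> W" "i \<noteq> j"
        by (rule nsets_2_cases)
      then show "e \<in> [W - S]\<^bsup>2\<^esup> \<union> [S]\<^bsup>2\<^esup> \<union> ?X"
        by (cases "i \<in> S"; cases "j \<in> S")
          (auto simp: doubleton_in_nsets_2 image_iff doubleton_eq_iff)
    qed
    show "[W - S]\<^bsup>2\<^esup> \<union> [S]\<^bsup>2\<^esup> \<union> ?X \<subseteq> [W]\<^bsup>2\<^esup>"
      using assms(2) nsets_mono[of "W - S" W 2] nsets_mono[of S W 2]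
      by (auto simp: doubleton_in_nsets_2)
  qed
  have disj: "[W - S]\<^bsup>2\<^esup> \<inter> [S]\<^bsup>2\<^esup> = {}" "([W - S]\<^bsup>2\<^esup> \<union> [S]\<^bsup>2\<^esup>) \<inter> ?X = {}"
    by (auto simp: nsets_def card_2_iff)
  have "sum f ?X = (\<Sum>p\<in>(W - S) \<times> S. f (?pair p))"
    by (subst sum.reindex) (auto simp: inj_on_def doubleton_eq_iff)
  also have "\<dots> = (\<Sum>j\<in>W - S. \<Sum>i\<in>S. f {i, j})"
    by (simp add: sum.cartesian_product case_prod_unfold)
  finally show ?thesis
    unfolding split using disj fin by (simp add: sum.union_disjoint finite_imp_finite_nsets)
qed

section \<open>Charging a single pair to its LP cost\<close>

locale lcc_rounding =
  fixes V :: "'a set" and E :: "'a set set" and l :: real and x :: "'a set \<Rightarrow> real"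
  assumes finite_V: "finite V"
    and l_gt: "1 / 2 < l" and l_lt: "l < 1"
    and feasible: "lcc_lp_feasible V x"
begin

abbreviation lp_cost :: "'a set \<Rightarrow> real" where
  "lp_cost \<equiv> pair_cost E l x"

abbreviation cut_cost :: "'a set \<Rightarrow> real" where
  "cut_cost \<equiv> pair_cost E l (\<lambda>_. 1)"

abbreviation join_cost :: "'a set \<Rightarrow> real" where
  "join_cost \<equiv> pair_cost E l (\<lambda>_. 0)"

lemma triangle:
  assumes "i \<in> V" "j \<in> V" "k \<in> V" "i \<noteq> j" "i \<noteq> k" "j \<noteq> k"
  shows "x {i, j} \<le> x {i, k} + x {k, j}"
  using feasible assms unfolding lcc_lp_feasible_def by (metis insert_commute)

lemma x_bounds:
  assumes "i \<in> V" "j \<in> V" "i \<noteq> j"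
  shows "0 \<le> x {i, j}" "x {i, j} \<le> 1"
  using feasible assms unfolding lcc_lp_feasible_def by auto

lemma cut_cost_le: "cut_cost e \<le> 1 - l"
  using l_lt by (simp add: pair_cost_def)

text \<open>Here \<open>l > 1/2\<close> enters: \<open>1 - l \<le> l\<close> lets one bound serve
  edges and non-edges alike, so cut edges may be charged to non-edges.\<close>

lemma lp_cost_ge:
  assumes "0 \<le> c" "c \<le> 1 - x e" "c \<le> x e"
  shows "(1 - l) * c \<le> lp_cost e"
proof (cases "e \<in> E")
  case True
  then show ?thesis
    using assms l_lt by (simp add: pair_cost_def)
next
  case False
  have "(1 - l) * c \<le> l * (1 - x e)"
    using assms l_gt l_lt by (intro mult_mono) auto
  then show ?thesis
    using False by (simp add: pair_cost_def)
qed

text \<open>Only edges pay when cut, and for them \<open>5 * x e \<ge> 1\<close>.\<close>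

lemma cut_cost_le_lp_cost:
  assumes "1 / 5 \<le> x e" "x e \<le> 1"
  shows "cut_cost e \<le> 5 * lp_cost e"
proof -
  have "(1 - l) * 1 \<le> (1 - l) * (5 * x e)"
    using assms l_lt by (intro mult_left_mono) auto
  then show ?thesis
    using assms l_gt by (simp add: pair_cost_def)
qed

text \<open>Only non-edges pay when joined, and for them \<open>5 * (1 - x e) \<ge> 1\<close>. The
  threshold is twice the radius \<open>2/5\<close>.\<close>

lemma join_cost_le_lp_cost:
  assumes "0 \<le> x e" "x e \<le> 4 / 5"
  shows "join_cost e \<le> 5 * lp_cost e"
proof -
  have "l * 1 \<le> l * (5 * (1 - x e))"
    using assms l_gt by (intro mult_left_mono) auto
  then show ?thesis
    using assms l_lt by (simp add: pair_cost_def mult.left_commute)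
qed

section \<open>Charging one iteration\<close>

lemma pivot_cluster_subset: "u \<in> W \<Longrightarrow> pivot_cluster x W u \<subseteq> W"
  by (auto simp: pivot_cluster_def Let_def)

lemma pivot_in_cluster: "u \<in> pivot_cluster x W u"
  by (simp add: pivot_cluster_def Let_def)

lemma pivot_cluster_close:
  assumes "i \<in> pivot_cluster x W u" "i \<noteq> u"
  shows "x {u, i} \<le> 2 / 5"
  using assms by (auto simp: pivot_cluster_def Let_def split: if_splits)

lemma join_cost_pivot_cluster:
  assumes "W \<subseteq> V" "u \<in> W" "e \<in> [pivot_cluster x W u]\<^bsup>2\<^esup>"
  shows "join_cost e \<le> 5 * lp_cost e"
proof -
  obtain i j where ij: "e = {i, j}" "i \<noteq> j"
      "i \<in> pivot_cluster x W u" "j \<in> pivot_cluster x W u"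
    using assms(3) by (rule nsets_2_cases)
  have V: "i \<in> V" "j \<in> V" "u \<in> V"
    using ij assms pivot_cluster_subset by blast+
  have "x {i, j} \<le> 4 / 5"
  proof (cases "i = u \<or> j = u")
    case True
    then show ?thesis
      using ij pivot_cluster_close[of j W u] pivot_cluster_close[of i W u]
      by (auto simp: insert_commute)
  next
    case False
    then show ?thesis
      using triangle[OF V(1,2,3)] ij pivot_cluster_close[of j W u] pivot_cluster_close[of i W u]
      by (auto simp: insert_commute)
  qed
  then show ?thesis
    using join_cost_le_lp_cost[of e] x_bounds(1)[OF V(1,2)] ij by auto
qed

lemma cut_cost_singleton:
  assumes W: "W \<subseteq> V" "u \<in> W"
    and T: "T = {i \<in> W - {u}. x {u, i} \<le> 2 / 5}"
    and far: "T = {} \<or> 1 / 5 \<le> (1 / real (card T)) * (\<Sum>i\<in>T. x {u, i})"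
  shows "(\<Sum>j\<in>W - {u}. cut_cost {u, j}) \<le> 5 * (\<Sum>j\<in>W - {u}. lp_cost {u, j})"
proof -
  have fin: "finite (W - {u})"
    using finite_subset[OF W(1) finite_V] by simp
  have T_sub: "T \<subseteq> W - {u}"
    using T by blast
  have bounds: "0 \<le> x {u, i}" "x {u, i} \<le> 1" if "i \<in> W - {u}" for i
    using x_bounds[of u i] that W by auto
  \<comment> \<open>Beyond \<open>T\<close> the distance exceeds \<open>2/5\<close>, so each pair
    pays for itself; within \<open>T\<close> only the average is controlled.\<close>
  have outside: "(\<Sum>j\<in>W - {u} - T. cut_cost {u, j}) \<le> (\<Sum>j\<in>W - {u} - T. 5 * lp_cost {u, j})"
    using T bounds by (intro sum_mono cut_cost_le_lp_cost) auto
  have avg: "real (card T) \<le> 5 * (\<Sum>i\<in>T. x {u, i})"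
  proof (cases "T = {}")
    case False
    then have "0 < real (card T)"
      using finite_subset[OF T_sub fin] by (simp add: card_gt_0_iff)
    then show ?thesis
      using far False by (simp add: field_simps)
  qed simp
  have "(\<Sum>j\<in>T. cut_cost {u, j}) \<le> (\<Sum>j\<in>T. 1 - l)"
    by (intro sum_mono cut_cost_le)
  also have "\<dots> = (1 - l) * real (card T)"
    by simp
  also have "\<dots> \<le> (1 - l) * (5 * (\<Sum>i\<in>T. x {u, i}))"
    using avg l_lt by (intro mult_left_mono) auto
  also have "\<dots> = 5 * (\<Sum>i\<in>T. (1 - l) * x {u, i})"
    by (simp flip: sum_distrib_left)
  \<comment> \<open>\<open>lp_cost_ge\<close> with \<open>c = x {u, i}\<close>, admissible since
    \<open>x {u, i} \<le> 2/5\<close> gives \<open>x {u, i} \<le> 1 - x {u, i}\<close>.\<close>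
  also have "\<dots> \<le> 5 * (\<Sum>i\<in>T. lp_cost {u, i})"
    using T bounds by (intro mult_left_mono sum_mono lp_cost_ge) force+
  finally have inside: "(\<Sum>j\<in>T. cut_cost {u, j}) \<le> 5 * (\<Sum>j\<in>T. lp_cost {u, j})" .
  show ?thesis
    using outside inside
    by (simp add: sum.subset_diff[OF T_sub fin] sum_distrib_left[symmetric] distrib_left)
qed

lemma cut_cost_ball:
  assumes W: "W \<subseteq> V" "u \<in> W"
    and T: "T = {i \<in> W - {u}. x {u, i} \<le> 2 / 5}"
    and near: "(\<Sum>i\<in>T. x {u, i}) \<le> real (card T) / 5"
    and j: "j \<in> W - insert u T"
  shows "(\<Sum>i\<in>insert u T. cut_cost {i, j}) \<le> 5 * (\<Sum>i\<in>insert u T. lp_cost {i, j})"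
proof -
  have fin: "finite T" and u: "u \<notin> T"
    using finite_subset[OF W(1) finite_V] T by auto
  have uj: "2 / 5 < x {u, j}" "x {u, j} \<le> 1"
    using j T W x_bounds[of u j] by auto
  have T_facts: "x {u, i} \<le> 2 / 5" "0 \<le> x {u, i}" "0 \<le> x {i, j}" "x {i, j} \<le> 1"
      "x {u, j} \<le> x {u, i} + x {i, j}" "x {i, j} \<le> x {u, i} + x {u, j}" if "i \<in> T" for i
  proof -
    have V: "i \<in> V" "j \<in> V" "u \<in> V" "i \<noteq> j" "i \<noteq> u" "j \<noteq> u"
      using that j T W by auto
    show "x {u, i} \<le> 2 / 5" "0 \<le> x {u, i}" "0 \<le> x {i, j}" "x {i, j} \<le> 1"
      using that T x_bounds V by auto
    show "x {u, j} \<le> x {u, i} + x {i, j}"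
      using triangle[of u j i] V by auto
    show "x {i, j} \<le> x {u, i} + x {u, j}"
      using triangle[of i j u] V by (auto simp: insert_commute)
  qed
  show ?thesis
  proof (cases "x {u, j} \<ge> 3 / 5")
    case True
    \<comment> \<open>For \<open>i\<close> in \<open>T\<close>,
      \<open>x {i, j} \<ge> x {u, j} - x {u, i} \<ge> 3/5 - 2/5\<close>.\<close>
    have "1 / 5 \<le> x {i, j} \<and> x {i, j} \<le> 1" if "i \<in> insert u T" for i
      using that True uj T_facts[of i] by (cases "i = u") auto
    then show ?thesis
      unfolding sum_distrib_left by (intro sum_mono cut_cost_le_lp_cost) auto
  next
    case False
    have "(\<Sum>i\<in>T. cut_cost {i, j}) \<le> (\<Sum>i\<in>T. 1 - l)"
      by (intro sum_mono cut_cost_le)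
    also have "\<dots> = (1 - l) * real (card T)"
      by simp
    \<comment> \<open>By \<open>near\<close>, the terms \<open>2/5 - x {u, i}\<close> add up to at
      least \<open>card T * (2/5 - 1/5)\<close>.\<close>
    also have "\<dots> \<le> (1 - l) * (5 * (\<Sum>i\<in>T. 2 / 5 - x {u, i}))"
      using near l_lt by (intro mult_left_mono) (auto simp: sum_subtractf)
    also have "\<dots> = 5 * (\<Sum>i\<in>T. (1 - l) * (2 / 5 - x {u, i}))"
      by (simp flip: sum_distrib_left)
    also have "\<dots> \<le> 5 * (\<Sum>i\<in>T. lp_cost {i, j})"
    proof (intro mult_left_mono sum_mono lp_cost_ge)
      fix i assume "i \<in> T"
      note facts = T_facts[OF this]
      \<comment> \<open>The lower bound \<open>2/5\<close> on \<open>x {u, j}\<close> bounds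
        \<open>x {i, j}\<close> from below; the upper bound \<open>3/5\<close> bounds
        \<open>1 - x {i, j}\<close> from below.\<close>
      show "0 \<le> 2 / 5 - x {u, i}" "2 / 5 - x {u, i} \<le> x {i, j}"
          "2 / 5 - x {u, i} \<le> 1 - x {i, j}"
        using facts uj False by linarith+
    qed simp
    \<comment> \<open>The pivot's own pair \<open>{u, j}\<close> is charged separately, as
      \<open>x {u, j} > 2/5\<close>.\<close>
    finally show ?thesis
      using fin u cut_cost_le_lp_cost[of "{u, j}"] uj by simp
  qed
qed

lemma cut_cost_pivot_cluster:
  assumes W: "W \<subseteq> V" "u \<in> W" and S: "S = pivot_cluster x W u"
  shows "(\<Sum>j\<in>W - S. \<Sum>i\<in>S. cut_cost {i, j}) \<le> 5 * (\<Sum>j\<in>W - S. \<Sum>i\<in>S. lp_cost {i, j})"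
proof -
  define T where "T = {i \<in> W - {u}. x {u, i} \<le> 2 / 5}"
  let ?near = "T \<noteq> {} \<and> (1 / real (card T)) * (\<Sum>i\<in>T. x {u, i}) < 1 / 5"
  have S_eq: "S = (if ?near then insert u T else {u})"
    unfolding S pivot_cluster_def T_def[symmetric] Let_def by simp
  show ?thesis
  proof (cases ?near)
    case True
    have "0 < real (card T)"
      using True finite_subset[OF W(1) finite_V] by (auto simp: T_def card_gt_0_iff)
    then have "(\<Sum>i\<in>T. x {u, i}) \<le> real (card T) / 5"
      using True by (simp add: field_simps)
    \<comment> \<open>The factor 5 is moved into the outer sum only: the averaging over the cluster
      is done for each outside node \<open>j\<close> separately.\<close>
    then show ?thesis
      unfolding S_eq if_P[OF True] unfolding sum_distrib_left[of 5 _ "W - insert u T"]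
      by (intro sum_mono cut_cost_ball[OF W T_def])
  next
    case False
    then show ?thesis
      unfolding S_eq if_not_P[OF False] using cut_cost_singleton[OF W T_def] by auto
  qed
qed

section \<open>Induction over the iterations of the loop\<close>

lemma rounding_bound:
  assumes "lcc_round x W C D" and "W \<subseteq> V"
  shows "\<exists>P. D = C \<union> P \<and> partition_on W P \<and>
    sum (pair_cost E l (separation P)) ([W]\<^bsup>2\<^esup>) \<le> 5 * sum lp_cost ([W]\<^bsup>2\<^esup>)"
  using assms
proof (induction rule: lcc_round.induct)
  case (finished C)
  show ?case
  proof (intro exI conjI)
    have "[{}]\<^bsup>2\<^esup> = ({} :: 'a set set)"
      by (auto simp: nsets_def)
    then show "sum (pair_cost E l (separation {})) ([{}]\<^bsup>2\<^esup>) \<le> 5 * sum lp_cost ([{}]\<^bsup>2\<^esup>)"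
      by simp
  qed (simp_all add: partition_on_def)
next
  case (pivot u W C D)
  define S where "S = pivot_cluster x W u"
  have S: "S \<subseteq> W" "u \<in> S"
    using pivot_cluster_subset[OF pivot.hyps(1)] pivot_in_cluster by (auto simp: S_def)
  \<comment> \<open>\<open>P\<close> collects the clusters formed after \<open>S\<close>. Keeping it
    apart from the accumulated ones makes the bound concern only pairs of unclustered nodes.\<close>
  obtain P where D: "D = C \<union> {S} \<union> P" and P: "partition_on (W - S) P"
    and bound: "sum (pair_cost E l (separation P)) ([W - S]\<^bsup>2\<^esup>) \<le> 5 * sum lp_cost ([W - S]\<^bsup>2\<^esup>)"
    using pivot.IH pivot.prems unfolding S_def by blast
  have P_sub: "A \<subseteq> W - S" if "A \<in> P" for A
    using P that by (auto simp: partition_on_def)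
  let ?cost = "pair_cost E l (separation (insert S P))"
  have part: "partition_on W (insert S P)"
    using partition_on_insert[of S P W] P S P_sub by (auto simp: disjnt_def)
  \<comment> \<open>A pair outside \<open>S\<close> is not contained in \<open>S\<close>, so adding
    \<open>S\<close> leaves its separation value unchanged.\<close>
  have rest: "sum ?cost ([W - S]\<^bsup>2\<^esup>) = sum (pair_cost E l (separation P)) ([W - S]\<^bsup>2\<^esup>)"
  proof (rule sum.cong[OF refl])
    fix e assume "e \<in> [W - S]\<^bsup>2\<^esup>"
    then have "\<not> e \<subseteq> S"
      by (auto elim!: nsets_2_cases)
    then show "?cost e = pair_cost E l (separation P) e"
      by (simp add: pair_cost_def separation_def)
  qed
  have "sum ?cost ([S]\<^bsup>2\<^esup>) = sum join_cost ([S]\<^bsup>2\<^esup>)"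
    by (intro sum.cong) (auto simp: pair_cost_def separation_def nsets_def)
  also have "\<dots> \<le> 5 * sum lp_cost ([S]\<^bsup>2\<^esup>)"
    unfolding sum_distrib_left S_def
    by (intro sum_mono join_cost_pivot_cluster[OF pivot.prems pivot.hyps(1)])
  finally have inner: "sum ?cost ([S]\<^bsup>2\<^esup>) \<le> 5 * sum lp_cost ([S]\<^bsup>2\<^esup>)" .
  \<comment> \<open>All later clusters lie in \<open>W - S\<close>, so every pair crossing the
    boundary of \<open>S\<close> stays separated.\<close>
  have "(\<Sum>j\<in>W - S. \<Sum>i\<in>S. ?cost {i, j}) = (\<Sum>j\<in>W - S. \<Sum>i\<in>S. cut_cost {i, j})"
  proof (intro sum.cong refl)
    fix i j assume "j \<in> W - S" "i \<in> S"
    then have "\<not> (\<exists>A\<in>insert S P. {i, j} \<subseteq> A)"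
      using P_sub by blast
    then have "separation (insert S P) {i, j} = 1"
      unfolding separation_def by (rule if_not_P)
    then show "?cost {i, j} = cut_cost {i, j}"
      by (simp add: pair_cost_def)
  qed
  also have "\<dots> \<le> 5 * (\<Sum>j\<in>W - S. \<Sum>i\<in>S. lp_cost {i, j})"
    by (rule cut_cost_pivot_cluster[OF pivot.prems pivot.hyps(1) S_def])
  finally have cross: "(\<Sum>j\<in>W - S. \<Sum>i\<in>S. ?cost {i, j})
      \<le> 5 * (\<Sum>j\<in>W - S. \<Sum>i\<in>S. lp_cost {i, j})" .
  have "finite W"
    using finite_subset[OF pivot.prems finite_V] .
  then have "sum ?cost ([W]\<^bsup>2\<^esup>) \<le> 5 * sum lp_cost ([W]\<^bsup>2\<^esup>)"
    using bound rest inner cross S(1) by (simp add: sum_nsets_2_split[of W S])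
  then show ?case
    using D part by (intro exI[of _ "insert S P"]) auto
qed

end

theorem theorem7:
  fixes V :: "'a set" and E :: "'a set set" and l :: real
    and x :: "'a set \<Rightarrow> real" and C :: "'a set set"
  assumes "finite V" and "E \<subseteq> [V]\<^bsup>2\<^esup>"
    and "1 / 2 < l" and "l < 1"
    and "lcc_lp_optimal V E l x"
    and "lcc_round x V {} C"
  shows "partition_on V C \<and>
    lcc_objective V E l C \<le> 5 * Min (lcc_objective V E l ` {P. partition_on V P})"
proof -
  have opt: "lcc_lp_objective V E l x \<le> lcc_lp_objective V E l y" if "lcc_lp_feasible V y" for y
    using assms(5) that by (auto simp: lcc_lp_optimal_def is_arg_min_linorder)
  interpret lcc_rounding V E l x
    using assms(1,3,4,5)
    by unfold_locales (auto simp: lcc_lp_optimal_def is_arg_min_linorder)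
  have part: "partition_on V C"
    and bound: "lcc_objective V E l C \<le> 5 * lcc_lp_objective V E l x"
    using rounding_bound[OF assms(6)]
    by (auto simp: lcc_objective_eq_lp_objective[OF assms(1,2)]
        lcc_lp_objective_eq_sum_pair_cost[OF assms(1,2)])
  have "finite {P. partition_on V P}"
    using finitely_many_partition_on[OF assms(1)] .
  \<comment> \<open>Each partition is a feasible LP point of the same value. \<open>C\<close> itself
    shows that the set under \<open>Min\<close> is nonempty.\<close>
  then have "lcc_lp_objective V E l x \<le> Min (lcc_objective V E l ` {P. partition_on V P})"
    using part opt separation_feasible lcc_objective_eq_lp_objective[OF assms(1,2)]
    by (subst Min_ge_iff) auto
  then show ?thesis
    using part bound by linarith
qed

end
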